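(* Let $w\in\mathfrak{S}_n$ be a permutation. The Stanley symmetric function $F_w$ attains its upper bound if and only if $w$ avoids the patterns $312$ and $321$.
   Context: Notation: $[n]=\{1,\ldots,n\}$; $w=w_1\cdots w_n$ in one-line notation. $w$ contains a pattern $v=v_1\cdots v_m\in\mathfrak{S}_m$ if there are indices $i_1<\cdots<i_m$ such that $w_{i_1},\ldots,w_{i_m}$ are in the same relative order as $v_1,\ldots,v_m$; otherwise $w$ avoids $v$. The Rothe diagram of $w$ is $$D(w)=\{(i,j)\in[n]^2:\ j<w_i,\ i<w^{-1}(j)\}.$$ A diagram $D\subseteq[n]^2$ is identified with the list $D=(D_1,\ldots,D_n)$, $D_j=\{i:(i,j)\in D\}$. For a diagram $C=(C_1,\ldots,C_n)$ put $\mathbf{x}^C=\prod_{j=1}^n\prod_{i\in C_j}x_i$. Schur character: let $Y=(y_{i,j})_{1\le i,j\le n}$ be a matrix of indeterminates. For $C$ with $|C_j|=|D_j|$ for all $j$, let $Y_{D_j}^{C_j}$ be the submatrix of $Y$ with row set $C_j$ and column set $D_j$ (in increasing order; the empty determinant is $1$). The Weyl module is $$\mathbb{W}_D=\mathrm{Span}_{\mathbb{C}}\Big\{\prod_{j=1}^n\det\big(Y_{D_j}^{C_j}\big)\ :\ C_j\subseteq[n],\ |C_j|=|D_j|\text{ for all }j\Big\}\subset\mathbb{C}[Y],$$ with $GL_n(\mathbb{C})$ acting by $f(Y)\cdot g=f(g^{-1}Y)$. For a $GL_n(\mathbb{C})$-module $N$, $\mathrm{char}(N)(x_1,\ldots,x_n)$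 is the trace on $N$ of the diagonal matrix with entries $x_1,\ldots,x_n$. The Schur character is $\chi_D(x_1,\ldots,x_n)=\mathrm{char}(\mathbb{W}_D)(x_1^{-1},\ldots,x_n^{-1})$. Stanley symmetric function: the convention is that $F_w$ is the Schur function of the Rothe diagram, $F_w=s_{D(w)}$; in the $n$ variables $\mathbf{x}=(x_1,\ldots,x_n)$ this is the Schur character, $F_w(x_1,\ldots,x_n)=\chi_{D(w)}(x_1,\ldots,x_n)$. "$F_w$ attains its upper bound" means that, with $D=D(w)$, $$\chi_{D}(\mathbf{x})=\sum_{\{C:\ |C_j|=|D_j|\ \forall j\in[n]\}}\mathbf{x}^C,$$ the sum over all diagrams $C=(C_1,\ldots,C_n)$, $C_j\subseteq[n]$, with $|C_j|=|D_j|$ for all $j$. *)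

theory Defs
  imports
    Complex_Main
    "HOL-Library.Poly_Mapping"
    "HOL-Combinatorics.Permutations"
    "Jordan_Normal_Form.Determinant"
    "Jordan_Normal_Form.DL_Submatrix"
    "Jordan_Normal_Form.Gauss_Jordan_Elimination"
begin

text \<open>
  A permutation of \<open>[n] = {1..n}\<close> is a function \<open>w\<close> with \<open>w permutes {1..n}\<close>,
  and \<open>w i\<close> is the entry \<open>w\<^sub>i\<close> of its one-line notation.
  A pattern is given by its one-line notation as a list.
\<close>

definition contains_pattern :: "nat \<Rightarrow> (nat \<Rightarrow> nat) \<Rightarrow> nat list \<Rightarrow> bool" where
  "contains_pattern n w v \<longleftrightarrow>
     (\<exists>p. length p = length v \<and> sorted_wrt (<) p \<and> set p \<subseteq> {1..n} \<and>
        (\<forall>a<length v. \<forall>b<length v. w (p ! a) < w (p ! b) \<longleftrightarrow> v ! a < v ! b))"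

definition avoids_pattern :: "nat \<Rightarrow> (nat \<Rightarrow> nat) \<Rightarrow> nat list \<Rightarrow> bool" where
  "avoids_pattern n w v \<longleftrightarrow> \<not> contains_pattern n w v"

definition rothe_diagram :: "nat \<Rightarrow> (nat \<Rightarrow> nat) \<Rightarrow> (nat \<times> nat) set" where
  "rothe_diagram n w = {(i, j) \<in> {1..n} \<times> {1..n}. j < w i \<and> i < inv_into UNIV w j}"

definition diagram_column :: "(nat \<times> nat) set \<Rightarrow> nat \<Rightarrow> nat set" where
  "diagram_column D j = {i. (i, j) \<in> D}"

definition same_column_sizes :: "nat \<Rightarrow> (nat \<times> nat) set \<Rightarrow> (nat \<times> nat) set set" where
  "same_column_sizes n D =
     {C. C \<subseteq> {1..n} \<times> {1..n} \<and>
         (\<forall>j\<in>{1..n}. card (diagram_column C j) = card (diagram_column D j))}"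

definition diagram_monomial :: "nat \<Rightarrow> (nat \<times> nat) set \<Rightarrow> (nat \<Rightarrow> complex) \<Rightarrow> complex" where
  "diagram_monomial n C x = (\<Prod>j\<in>{1..n}. \<Prod>i\<in>diagram_column C j. x i)"

text \<open>
  Complex polynomials in indeterminates \<open>y\<^sub>i\<^sub>j\<close> with arbitrary \<open>i, j\<close>. For a given \<open>n\<close> only
  those with \<open>i, j \<in> {1..n}\<close> occur in the Weyl module, so that it lies in \<open>\<complex>[Y]\<close> for the
  \<open>n \<times> n\<close> matrix \<open>Y\<close>.
\<close>

type_synonym ypoly = "((nat \<times> nat) \<Rightarrow>\<^sub>0 nat) \<Rightarrow>\<^sub>0 complex"

definition yconst :: "complex \<Rightarrow> ypoly" where
  "yconst c = Poly_Mapping.single 0 c"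

definition yvar :: "nat \<times> nat \<Rightarrow> ypoly" where
  "yvar v = Poly_Mapping.single (Poly_Mapping.single v 1) 1"

definition yscale :: "complex \<Rightarrow> ypoly \<Rightarrow> ypoly" where
  "yscale c p = yconst c * p"

global_interpretation ypoly: vector_space yscale
  by unfold_locales
    (simp_all add: yscale_def yconst_def distrib_left distrib_right single_add mult_single
      flip: mult.assoc)

definition ysubst :: "(nat \<times> nat \<Rightarrow> ypoly) \<Rightarrow> ypoly \<Rightarrow> ypoly" where
  "ysubst \<theta> p =
     (\<Sum>m\<in>Poly_Mapping.keys p. yconst (Poly_Mapping.lookup p m) *
        (\<Prod>v\<in>Poly_Mapping.keys m. \<theta> v ^ Poly_Mapping.lookup m v))"

text \<open>Matrix positions are counted from \<open>0\<close>, the indices of the indeterminates from \<open>1\<close>.\<close>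

definition Ymat :: "nat \<Rightarrow> ypoly mat" where
  "Ymat n = Matrix.mat n n (\<lambda>(i, j). yvar (Suc i, Suc j))"

definition Yminor :: "nat \<Rightarrow> nat set \<Rightarrow> nat set \<Rightarrow> ypoly" where
  "Yminor n R S = Determinant.det (submatrix (Ymat n) {i. Suc i \<in> R} {j. Suc j \<in> S})"

definition weyl_module :: "nat \<Rightarrow> (nat \<times> nat) set \<Rightarrow> ypoly set" where
  "weyl_module n D =
     ypoly.span ((\<lambda>C. \<Prod>j\<in>{1..n}. Yminor n (diagram_column C j) (diagram_column D j))
                 ` same_column_sizes n D)"

text \<open>
  The action \<open>f(Y) \<cdot> g = f(g\<^sup>-\<^sup>1 Y)\<close>, meaningful for invertible \<open>g \<in> carrier_mat n n\<close>.
  Indeterminates outside the \<open>n \<times> n\<close> matrix \<open>Y\<close> are left alone.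
\<close>

definition gl_act :: "nat \<Rightarrow> complex mat \<Rightarrow> ypoly \<Rightarrow> ypoly" where
  "gl_act n g =
     ysubst (\<lambda>(i, j). if i \<in> {1..n} \<and> j \<in> {1..n}
        then (map_mat yconst (the (mat_inverse g)) * Ymat n) $$ (i - 1, j - 1)
        else yvar (i, j))"

text \<open>
  The trace on a finite-dimensional subspace \<open>N\<close> of a linear map that sends \<open>N\<close> to itself;
  the choice of the basis does not matter.
\<close>

definition trace_on :: "ypoly set \<Rightarrow> (ypoly \<Rightarrow> ypoly) \<Rightarrow> complex" where
  "trace_on N T =
     (let B = (SOME B. finite B \<and> ypoly.independent B \<and> ypoly.span B = N)
      in \<Sum>b\<in>B. ypoly.representation B (T b) b)"

text \<open>
  Characters are functions of \<open>(x\<^sub>1, \<dots>, x\<^sub>n)\<close> on the torus of points all of whose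
  coordinates are nonzero, where the diagonal matrix is invertible. Over the complex numbers such
  functions determine the corresponding (Laurent) polynomials.
\<close>

definition gl_char :: "nat \<Rightarrow> ypoly set \<Rightarrow> (nat \<Rightarrow> complex) \<Rightarrow> complex" where
  "gl_char n N x = trace_on N (gl_act n (mat_diag n (\<lambda>i. x (Suc i))))"

definition schur_char :: "nat \<Rightarrow> (nat \<times> nat) set \<Rightarrow> (nat \<Rightarrow> complex) \<Rightarrow> complex" where
  "schur_char n D x = gl_char n (weyl_module n D) (\<lambda>i. inverse (x i))"

definition stanley_fun :: "nat \<Rightarrow> (nat \<Rightarrow> nat) \<Rightarrow> (nat \<Rightarrow> complex) \<Rightarrow> complex" where
  "stanley_fun n w = schur_char n (rothe_diagram n w)"

definition stanley_attains_upper_bound :: "nat \<Rightarrow> (nat \<Rightarrow> nat) \<Rightarrow> bool" where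
  "stanley_attains_upper_bound n w \<longleftrightarrow>
     (\<forall>x. (\<forall>i\<in>{1..n}. x i \<noteq> 0) \<longrightarrow>
        stanley_fun n w x =
          (\<Sum>C\<in>same_column_sizes n (rothe_diagram n w). diagram_monomial n C x))"

end

theory Submission
  imports Defs "HOL-Library.Product_Lexorder"
begin

text \<open>
  A diagonal matrix acts on a product of minors with row sets \<open>C\<^sub>j\<close> by the scalar \<open>x\<^sup>C\<close>. Hence the
  upper bound holds iff these products form a linearly independent family; the case \<open>x = 1\<close>,
  which compares dimensions, gives the nontrivial direction.

  If the columns of the diagram are pairwise disjoint sets of rows, the minors involve disjoint
  sets of indeterminates, and evaluations of \<open>Y\<close> at suitable 0/1-matrices are dual to the family. If
  \<open>S = D\<^sub>j\<close> and \<open>T = D\<^sub>k\<close> intersect and \<open>S \<union> T \<noteq> [n]\<close>, keep \<open>|S \<inter> T| - 1\<close> rows of the \<open>S\<close>-minor fixed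
  and antisymmetrise the product of the two minors over the other \<open>|S \<union> T| + 1\<close> rows: since only
  \<open>|S \<union> T|\<close> columns are involved, the result is \<open>0\<close>, and this is a nontrivial relation in the family.

  Finally, two columns of \<open>D(w)\<close> share a row iff \<open>w\<close> contains \<open>312\<close> or \<open>321\<close>, and row \<open>n\<close> of \<open>D(w)\<close> is
  always empty.
\<close>

subsection \<open>Substitution homomorphisms\<close>

abbreviation ymonom :: "(nat \<times> nat \<Rightarrow> ypoly) \<Rightarrow> ((nat \<times> nat) \<Rightarrow>\<^sub>0 nat) \<Rightarrow> ypoly" where
  "ymonom \<theta> m \<equiv> (\<Prod>v\<in>Poly_Mapping.keys m. \<theta> v ^ Poly_Mapping.lookup m v)"

text \<open>Indeterminates outside \<open>m\<close> only contribute factors with exponent 0, so two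
  monomials can be written over one common finite set.\<close>

lemma ymonom_superset:
  assumes "finite V" "Poly_Mapping.keys m \<subseteq> V"
  shows "ymonom \<theta> m = (\<Prod>v\<in>V. \<theta> v ^ Poly_Mapping.lookup m v)"
  using assms by (intro prod.mono_neutral_left) (auto simp: in_keys_iff)

lemma ymonom_add: "ymonom \<theta> (m + m') = ymonom \<theta> m * ymonom \<theta> m'"
proof -
  define V where "V = Poly_Mapping.keys m \<union> Poly_Mapping.keys m'"
  have V: "finite V" "Poly_Mapping.keys m \<subseteq> V" "Poly_Mapping.keys m' \<subseteq> V"
    "Poly_Mapping.keys (m + m') \<subseteq> V"
    using keys_add[of m m'] by (auto simp: V_def)
  show ?thesis
    unfolding ymonom_superset[OF V(1,2)] ymonom_superset[OF V(1,3)] ymonom_superset[OF V(1,4)]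
    by (simp add: lookup_add power_add prod.distrib)
qed

lemma yconst_add: "yconst (a + b) = yconst a + yconst b"
  by (simp add: yconst_def single_add)

lemma yconst_mult: "yconst (a * b) = yconst a * yconst b"
  by (simp add: yconst_def mult_single)

lemma yconst_0 [simp]: "yconst 0 = 0" and yconst_1 [simp]: "yconst 1 = 1"
  by (simp_all add: yconst_def)

lemma ysubst_superset:
  assumes "finite K" "Poly_Mapping.keys p \<subseteq> K"
  shows "ysubst \<theta> p = (\<Sum>m\<in>K. yconst (Poly_Mapping.lookup p m) * ymonom \<theta> m)"
  unfolding ysubst_def using assms
  by (intro sum.mono_neutral_left) (auto simp: in_keys_iff)

lemma ysubst_add: "ysubst \<theta> (p + q) = ysubst \<theta> p + ysubst \<theta> q"
proof -
  define K where "K = Poly_Mapping.keys p \<union> Poly_Mapping.keys q"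
  have K: "finite K" "Poly_Mapping.keys p \<subseteq> K" "Poly_Mapping.keys q \<subseteq> K"
    "Poly_Mapping.keys (p + q) \<subseteq> K"
    using keys_add[of p q] by (auto simp: K_def)
  show ?thesis
    unfolding ysubst_superset[OF K(1,2)] ysubst_superset[OF K(1,3)] ysubst_superset[OF K(1,4)]
    by (simp add: lookup_add yconst_add distrib_right sum.distrib)
qed

lemma ysubst_0 [simp]: "ysubst \<theta> 0 = 0"
  by (simp add: ysubst_def)

lemma ysubst_single: "ysubst \<theta> (Poly_Mapping.single m c) = yconst c * ymonom \<theta> m"
  by (simp add: ysubst_def keys_single)

lemma ysubst_sum: "ysubst \<theta> (sum f A) = (\<Sum>a\<in>A. ysubst \<theta> (f a))"
  by (induction A rule: infinite_finite_induct) (simp_all add: ysubst_add)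

lemma ypoly_sum_monomials:
  fixes p :: ypoly
  shows "p = (\<Sum>m\<in>Poly_Mapping.keys p. Poly_Mapping.single m (Poly_Mapping.lookup p m))"
  by (rule poly_mapping_eqI) (auto simp: lookup_sum lookup_single when_def in_keys_iff)

lemma ysubst_mult: "ysubst \<theta> (p * q) = ysubst \<theta> p * ysubst \<theta> q"
proof -
  have "p * q = (\<Sum>m\<in>Poly_Mapping.keys p. \<Sum>m'\<in>Poly_Mapping.keys q.
      Poly_Mapping.single (m + m') (Poly_Mapping.lookup p m * Poly_Mapping.lookup q m'))"
    by (subst (1) ypoly_sum_monomials[of p], subst (1) ypoly_sum_monomials[of q])
       (simp add: sum_product mult_single)
  then have "ysubst \<theta> (p * q) = (\<Sum>m\<in>Poly_Mapping.keys p. \<Sum>m'\<in>Poly_Mapping.keys q.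
      (yconst (Poly_Mapping.lookup p m) * ymonom \<theta> m) *
      (yconst (Poly_Mapping.lookup q m') * ymonom \<theta> m'))"
    by (simp add: ysubst_sum ysubst_single ymonom_add yconst_mult mult_ac)
  then show ?thesis
    by (simp add: ysubst_def sum_product)
qed

lemma ysubst_yconst [simp]: "ysubst \<theta> (yconst c) = yconst c"
  by (simp add: yconst_def ysubst_single)

lemma ysubst_yvar [simp]: "ysubst \<theta> (yvar v) = \<theta> v"
  by (simp add: yvar_def ysubst_single)

text \<open>Substitutions now commute with determinants (\<open>hom_det\<close>) and finite products
  (\<open>hom_prod\<close>), so products of minors can be evaluated factor by factor.\<close>

interpretation ysubst: comm_ring_hom "ysubst \<theta>" for \<theta>
proof
  show "ysubst \<theta> 1 = 1"
    using ysubst_yconst[of \<theta> 1] by simp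
qed (simp_all add: ysubst_add ysubst_mult)

lemma ysubst_yscale: "ysubst \<theta> (yscale c p) = yscale c (ysubst \<theta> p)"
  by (simp add: yscale_def ysubst_mult)

lemma yscale_prod: "(\<Prod>a\<in>A. yscale (c a) (f a)) = yscale (\<Prod>a\<in>A. c a) (\<Prod>a\<in>A. f a)"
  by (induction A rule: infinite_finite_induct) (simp_all add: yscale_def yconst_mult mult_ac)

subsection \<open>Minors\<close>

text \<open>The shift by \<open>Suc\<close> translates between \<open>pick\<close>, which works with
  matrix positions from 0, and the indices of the indeterminates from 1. The positions
  \<open>i\<close> themselves start at 0.\<close>

definition increasing_enum :: "nat set \<Rightarrow> nat \<Rightarrow> nat" where
  "increasing_enum R i = Suc (pick {r. Suc r \<in> R} i)"

lemma Suc_image_vimage: "0 \<notin> R \<Longrightarrow> Suc ` {r. Suc r \<in> R} = R"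
  by (auto simp: image_iff) (metis not0_implies_Suc)

lemma bij_betw_increasing_enum:
  assumes "finite R" "0 \<notin> R"
  shows "bij_betw (increasing_enum R) {0..<card R} R"
proof -
  let ?R = "{r. Suc r \<in> R}"
  have card: "card ?R = card R"
    using card_image[of Suc ?R] Suc_image_vimage[OF assms(2)] by simp
  have fin: "finite ?R"
    using Suc_image_vimage[OF assms(2)] assms(1) by (metis finite_imageD inj_Suc)
  have "R \<subseteq> increasing_enum R ` {0..<card R}"
  proof
    fix u assume "u \<in> R"
    then obtain r where r: "u = Suc r"
      using assms(2) by (cases u) auto
    \<comment> \<open>The position of \<open>r\<close> is the number of smaller elements.
      Surjectivity and equal finite cardinalities then give injectivity.\<close>
    let ?i = "card {a \<in> ?R. a < r}"
    have "?i < card R"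
      unfolding card[symmetric] using \<open>u \<in> R\<close> fin r by (intro psubset_card_mono) auto
    moreover have "u = increasing_enum R ?i"
      using pick_card_in_set[of r ?R] \<open>u \<in> R\<close> r by (simp add: increasing_enum_def)
    ultimately show "u \<in> increasing_enum R ` {0..<card R}"
      by auto
  qed
  moreover have "increasing_enum R ` {0..<card R} \<subseteq> R"
  proof
    fix u assume "u \<in> increasing_enum R ` {0..<card R}"
    then obtain i where i: "u = increasing_enum R i" "i < card R"
      by auto
    show "u \<in> R"
      using pick_in_set_le[of i ?R] card i by (simp add: increasing_enum_def del: pick.simps)
  qed
  ultimately have "increasing_enum R ` {0..<card R} = R"
    by (rule subset_antisym[rotated])
  then show ?thesis
    by (simp add: bij_betw_def eq_card_imp_inj_on)
qed

lemma increasing_enum_in: "finite R \<Longrightarrow> 0 \<notin> R \<Longrightarrow> i < card R \<Longrightarrow> increasing_enum R i \<in> R"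
  using bij_betw_increasing_enum[of R] by (auto simp: bij_betw_def)

lemma Yminor_eq_det:
  assumes "R \<subseteq> {1..n}" "S \<subseteq> {1..n}" "card R = p" "card S = p"
  shows "Yminor n R S = Determinant.det (Matrix.mat p p (\<lambda>(i, j). yvar (increasing_enum R i, increasing_enum S j)))"
proof -
  have card: "card {i. i < n \<and> Suc i \<in> U} = card U" if "U \<subseteq> {1..n}" for U
  proof -
    have "{i. i < n \<and> Suc i \<in> U} = {i. Suc i \<in> U}" "0 \<notin> U"
      using that by auto
    then show ?thesis
      using card_image[of Suc "{i. Suc i \<in> U}"] Suc_image_vimage[of U] by simp
  qed
  have lt: "pick {i. Suc i \<in> U} i < n" if "U \<subseteq> {1..n}" "i < card U" for U i
    using pick_le[of i n "{i. Suc i \<in> U}"] card[OF that(1)] that(2) by simp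
  have "submatrix (Ymat n) {i. Suc i \<in> R} {j. Suc j \<in> S} =
      Matrix.mat p p (\<lambda>(i, j). yvar (increasing_enum R i, increasing_enum S j))"
    using assms lt[of R] lt[of S]
    by (intro eq_matI) (auto simp: submatrix_def Ymat_def increasing_enum_def card)
  then show ?thesis
    by (simp add: Yminor_def)
qed

lemma ysubst_Yminor:
  assumes "R \<subseteq> {1..n}" "S \<subseteq> {1..n}" "card R = p" "card S = p"
  shows "ysubst \<theta> (Yminor n R S) =
    Determinant.det (Matrix.mat p p (\<lambda>(i, j). \<theta> (increasing_enum R i, increasing_enum S j)))"
proof -
  have "map_mat (ysubst \<theta>) (Matrix.mat p p (\<lambda>(i, j). yvar (increasing_enum R i, increasing_enum S j))) =
      Matrix.mat p p (\<lambda>(i, j). \<theta> (increasing_enum R i, increasing_enum S j))"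
    by (intro eq_matI) auto
  then show ?thesis
    by (simp add: Yminor_eq_det[OF assms] flip: ysubst.hom_det)
qed

lemma permutes_lt: "\<pi> permutes {0..<p::nat} \<Longrightarrow> i < p \<Longrightarrow> \<pi> i < p"
  using permutes_in_image[of \<pi> "{0..<p}" i] by simp

subsection \<open>Characters and independence of products of minors\<close>

text \<open>\<open>trace_on\<close> uses an unspecified basis \<open>A\<close>. The change of basis
  matrices between \<open>A\<close> and \<open>B\<close> are inverse to each other, so exchanging
  the two sums moves the trace to the eigenbasis.\<close>

lemma trace_on_eigenbasis:
  assumes B: "finite B" "ypoly.independent B" "ypoly.span B = N"
    and T_add: "\<And>p q. T (p + q) = T p + T q"
    and T_scale: "\<And>a p. T (yscale a p) = yscale a (T p)"
    and T_eigen: "\<And>b. b \<in> B \<Longrightarrow> T b = yscale (\<mu> b) b"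
  shows "trace_on N T = (\<Sum>b\<in>B. \<mu> b)"
proof -
  define A where "A = (SOME B. finite B \<and> ypoly.independent B \<and> ypoly.span B = N)"
  have A: "finite A" "ypoly.independent A" "ypoly.span A = N"
    using someI_ex[of "\<lambda>B. finite B \<and> ypoly.independent B \<and> ypoly.span B = N"] B
    unfolding A_def by blast+
  let ?rA = "ypoly.representation A" and ?rB = "ypoly.representation B"
  have T_0: "T 0 = 0"
    using T_scale[of 0 0] by simp
  have T_sum: "T (sum f F) = (\<Sum>i\<in>F. T (f i))" for f :: "ypoly \<Rightarrow> ypoly" and F
    by (induction F rule: infinite_finite_induct) (simp_all add: T_0 T_add)
  have rB: "(\<Sum>b\<in>B. yscale (?rB a b) b) = a" if "a \<in> A" for a
    using that A(3) B ypoly.sum_representation_eq[of B a B] ypoly.span_base by blast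
  have rA: "(\<Sum>a\<in>A. yscale (?rA b a) a) = b" if "b \<in> B" for b
    using that A B(3) ypoly.sum_representation_eq[of A b A] ypoly.span_base by blast
  have AN: "a \<in> ypoly.span B" if "a \<in> A" for a
    using that A(3) B(3) ypoly.span_base by blast
  have BN: "b \<in> ypoly.span A" if "b \<in> B" for b
    using that A(3) B(3) ypoly.span_base by blast
  have rT: "?rA (T a) a = (\<Sum>b\<in>B. ?rB a b * (\<mu> b * ?rA b a))" if "a \<in> A" for a
  proof -
    have "T a = T (\<Sum>b\<in>B. yscale (?rB a b) b)"
      by (simp only: rB[OF that])
    also have "\<dots> = (\<Sum>b\<in>B. yscale (?rB a b) (yscale (\<mu> b) b))"
      by (simp add: T_sum T_scale T_eigen del: ypoly.scale_scale)
    finally have "?rA (T a) = ?rA (\<Sum>b\<in>B. yscale (?rB a b) (yscale (\<mu> b) b))"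
      by (simp only:)
    then show ?thesis
      using A(2) BN
      by (simp add: ypoly.representation_sum ypoly.representation_scale ypoly.span_scale
          del: ypoly.scale_scale)
  qed
  have "trace_on N T = (\<Sum>a\<in>A. ?rA (T a) a)"
    by (simp add: trace_on_def A_def Let_def)
  also have "\<dots> = (\<Sum>a\<in>A. \<Sum>b\<in>B. ?rB a b * (\<mu> b * ?rA b a))"
    by (rule sum.cong) (simp_all add: rT)
  also have "\<dots> = (\<Sum>b\<in>B. \<mu> b * (\<Sum>a\<in>A. ?rA b a * ?rB a b))"
    by (subst sum.swap) (simp add: sum_distrib_left mult_ac)
  also have "\<dots> = (\<Sum>b\<in>B. \<mu> b)"
  proof (rule sum.cong[OF refl])
    fix b assume b: "b \<in> B"
    \<comment> \<open>Expanding \<open>b\<close> in \<open>A\<close> and reading off its coordinate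
      at \<open>b\<close> in \<open>B\<close> shows that the inner sum is 1.\<close>
    have "?rB b b = ?rB (\<Sum>a\<in>A. yscale (?rA b a) a) b"
      by (simp only: rA[OF b])
    also have "\<dots> = (\<Sum>a\<in>A. ?rA b a * ?rB a b)"
      using B(2) AN by (simp add: ypoly.representation_sum ypoly.representation_scale ypoly.span_scale)
    finally show "\<mu> b * (\<Sum>a\<in>A. ?rA b a * ?rB a b) = \<mu> b"
      using ypoly.representation_basis[OF B(2) b] by simp
  qed
  finally show ?thesis .
qed

section \<open>The torus action on minors\<close>

lemma mat_inverse_diag:
  fixes d :: "nat \<Rightarrow> 'a :: field"
  assumes "\<And>i. i < n \<Longrightarrow> d i \<noteq> 0"
  shows "mat_inverse (mat_diag n (\<lambda>i. inverse (d i))) = Some (mat_diag n d)"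
proof -
  let ?A = "mat_diag n (\<lambda>i. inverse (d i))" and ?B = "mat_diag n d"
  have carrier: "?A \<in> carrier_mat n n" "?B \<in> carrier_mat n n"
    by auto
  have AB: "?A * ?B = 1\<^sub>m n" "?B * ?A = 1\<^sub>m n"
    using assms by (auto intro!: eq_matI simp: mat_diag_diag) (auto simp: mat_diag_def)
  \<comment> \<open>Being a unit excludes the result \<open>None\<close> of
    \<open>mat_inverse\<close>; uniqueness of inverses then identifies the matrix \<open>C\<close>
    that it returns.\<close>
  then have "?A \<in> Units (ring_mat TYPE('a) n undefined)"
    using carrier by (auto simp: Units_def ring_mat_def simp del: mat_diag_diag intro!: bexI[of _ ?B])
  then obtain C where C: "mat_inverse ?A = Some C"
    using mat_inverse(1)[OF carrier(1), where b = undefined] by (cases "mat_inverse ?A") auto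
  from mat_inverse(2)[OF carrier(1) C] have CA: "C * ?A = 1\<^sub>m n" "C \<in> carrier_mat n n"
    by auto
  have "C = C * (?A * ?B)"
    unfolding AB(1) using CA(2) by simp
  also have "\<dots> = C * ?A * ?B"
    by (rule assoc_mult_mat[OF CA(2) carrier, symmetric])
  also have "\<dots> = ?B"
    unfolding CA(1) using carrier(2) by (rule left_mult_one_mat)
  finally have "C = ?B" .
  with C show ?thesis
    by simp
qed

abbreviation row_scaling :: "nat \<Rightarrow> (nat \<Rightarrow> complex) \<Rightarrow> nat \<times> nat \<Rightarrow> ypoly" where
  "row_scaling n x \<equiv> \<lambda>(i, j). if i \<in> {1..n} \<and> j \<in> {1..n}
     then yscale (x i) (yvar (i, j)) else yvar (i, j)"

text \<open>The inverse in the definition of the Schur character cancels against the inverse in the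
  action, so row \<open>i\<close> of \<open>Y\<close> is multiplied by \<open>x i\<close>
  itself.\<close>

lemma gl_act_diag:
  assumes "\<And>i. i \<in> {1..n} \<Longrightarrow> x i \<noteq> 0"
  shows "gl_act n (mat_diag n (\<lambda>i. inverse (x (Suc i)))) = ysubst (row_scaling n x)"
proof -
  have inv: "mat_inverse (mat_diag n (\<lambda>i. inverse (x (Suc i)))) = Some (mat_diag n (\<lambda>i. x (Suc i)))"
    using assms by (intro mat_inverse_diag) auto
  have map: "map_mat yconst (mat_diag n (\<lambda>i. x (Suc i))) = mat_diag n (\<lambda>i. yconst (x (Suc i)))"
    by (auto intro!: eq_matI simp: mat_diag_def)
  have entry: "(mat_diag n (\<lambda>i. yconst (x (Suc i))) * Ymat n) $$ (i - 1, j - 1) =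
      yscale (x i) (yvar (i, j))" if "i \<in> {1..n}" "j \<in> {1..n}" for i j
    using that by (subst mat_diag_mult_left[of _ n n]) (auto simp: Ymat_def yscale_def)
  show ?thesis
    unfolding gl_act_def inv option.sel map
    by (rule arg_cong[where f = ysubst]) (auto simp: fun_eq_iff entry[unfolded One_nat_def])
qed

lemma yscale_mult_right: "p * yscale a q = yscale a (p * q)"
  by (simp add: yscale_def mult_ac)

text \<open>Each Leibniz term has exactly one entry from every row, hence collects every
  \<open>x i\<close> with \<open>i \<in> R\<close> exactly once.\<close>

lemma ysubst_row_scaling_Yminor:
  assumes "R \<subseteq> {1..n}" "S \<subseteq> {1..n}" "card R = card S"
  shows "ysubst (row_scaling n x) (Yminor n R S) = yscale (\<Prod>i\<in>R. x i) (Yminor n R S)"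
proof -
  define p where "p = card S"
  have fin: "finite R" "0 \<notin> R" "finite S" "0 \<notin> S"
    using assms finite_subset[OF _ finite_atLeastAtMost] by auto
  have bij: "bij_betw (increasing_enum R) {0..<p} R" "bij_betw (increasing_enum S) {0..<p} S"
    using bij_betw_increasing_enum[OF fin(1,2)] bij_betw_increasing_enum[OF fin(3,4)] assms(3) by (simp_all add: p_def)
  have R: "increasing_enum R i \<in> {1..n}" "increasing_enum S i \<in> {1..n}" if "i < p" for i
    using increasing_enum_in fin that assms by (auto simp: p_def subset_iff)
  have M: "Yminor n R S = Determinant.det (Matrix.mat p p (\<lambda>(i, j). yvar (increasing_enum R i, increasing_enum S j)))"
    using assms by (intro Yminor_eq_det) (auto simp: p_def)
  have "ysubst (row_scaling n x) (Yminor n R S) =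
      Determinant.det (Matrix.mat p p (\<lambda>(i, j). row_scaling n x (increasing_enum R i, increasing_enum S j)))"
    using assms by (simp add: ysubst_Yminor p_def)
  also have "\<dots> = (\<Sum>\<pi> | \<pi> permutes {0..<p}. signof \<pi> *
      (\<Prod>i = 0..<p. yscale (x (increasing_enum R i)) (yvar (increasing_enum R i, increasing_enum S (\<pi> i)))))"
    using R by (subst det_def'[of _ p]) (auto intro!: sum.cong prod.cong simp: permutes_lt)
  also have "\<dots> = yscale (\<Prod>i = 0..<p. x (increasing_enum R i)) (\<Sum>\<pi> | \<pi> permutes {0..<p}. signof \<pi> *
      (\<Prod>i = 0..<p. yvar (increasing_enum R i, increasing_enum S (\<pi> i))))"
    by (simp only: yscale_prod yscale_mult_right ypoly.scale_sum_right)
  also have "(\<Sum>\<pi> | \<pi> permutes {0..<p}. signof \<pi> *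
      (\<Prod>i = 0..<p. yvar (increasing_enum R i, increasing_enum S (\<pi> i)))) = Yminor n R S"
    unfolding M by (subst det_def'[of _ p]) (auto intro!: sum.cong prod.cong simp: permutes_lt)
  also have "(\<Prod>i = 0..<p. x (increasing_enum R i)) = (\<Prod>i\<in>R. x i)"
    using bij(1) by (rule prod.reindex_bij_betw)
  finally show ?thesis .
qed

section \<open>Products of minors and the character of the Weyl module\<close>

definition weyl_gen :: "nat \<Rightarrow> (nat \<times> nat) set \<Rightarrow> (nat \<times> nat) set \<Rightarrow> ypoly" where
  "weyl_gen n D C = (\<Prod>j\<in>{1..n}. Yminor n (diagram_column C j) (diagram_column D j))"

lemma diagram_column_subset: "C \<subseteq> {1..n} \<times> {1..n} \<Longrightarrow> diagram_column C j \<subseteq> {1..n}"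
  by (auto simp: diagram_column_def)

lemma same_column_sizesD:
  assumes "C \<in> same_column_sizes n D"
  shows "diagram_column C j \<subseteq> {1..n}"
    and "j \<in> {1..n} \<Longrightarrow> card (diagram_column C j) = card (diagram_column D j)"
  using assms by (auto simp: same_column_sizes_def diagram_column_def)

lemma finite_same_column_sizes: "finite (same_column_sizes n D)"
  by (rule finite_subset[of _ "Pow ({1..n} \<times> {1..n})"]) (auto simp: same_column_sizes_def)

text \<open>A basis chosen among the products of minors diagonalises the action. \<open>L\<close> is
  kept general so that it may be the whole index set or one extracted from it.\<close>

lemma schur_char_basis:
  assumes D: "D \<subseteq> {1..n} \<times> {1..n}"
    and x: "\<And>i. i \<in> {1..n} \<Longrightarrow> x i \<noteq> 0"
    and L: "L \<subseteq> same_column_sizes n D" "inj_on (weyl_gen n D) L"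
      "ypoly.independent (weyl_gen n D ` L)"
      "ypoly.span (weyl_gen n D ` L) = weyl_module n D"
  shows "schur_char n D x = (\<Sum>C\<in>L. diagram_monomial n C x)"
proof -
  let ?P = "weyl_gen n D"
  let ?T = "gl_act n (mat_diag n (\<lambda>i. inverse (x (Suc i))))"
  have T: "?T = ysubst (row_scaling n x)"
    using x by (rule gl_act_diag)
  have eigen: "?T (?P C) = yscale (diagram_monomial n C x) (?P C)" if "C \<in> L" for C
  proof -
    have "ysubst (row_scaling n x) (Yminor n (diagram_column C j) (diagram_column D j)) =
        yscale (\<Prod>i\<in>diagram_column C j. x i) (Yminor n (diagram_column C j) (diagram_column D j))"
      if "j \<in> {1..n}" for j
      using same_column_sizesD[of C n D] \<open>C \<in> L\<close> L(1) that diagram_column_subset[OF D]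
      by (intro ysubst_row_scaling_Yminor) auto
    then show ?thesis
      unfolding T weyl_gen_def
      by (simp add: ysubst.hom_prod diagram_monomial_def yscale_prod)
  qed
  have "schur_char n D x = trace_on (weyl_module n D) ?T"
    by (simp add: schur_char_def gl_char_def)
  \<comment> \<open>Eigenvalues have to be a function of the basis vector; injectivity on
    \<open>L\<close> recovers the diagram from its product.\<close>
  also have "\<dots> = (\<Sum>b\<in>?P ` L. diagram_monomial n (the_inv_into L ?P b) x)"
  proof (rule trace_on_eigenbasis)
    show "finite (?P ` L)"
      using finite_subset[OF L(1) finite_same_column_sizes] by blast
    show "?T (p + q) = ?T p + ?T q" "?T (yscale a p) = yscale a (?T p)" for a p q
      by (simp_all only: T ysubst_add ysubst_yscale)
    show "?T b = yscale (diagram_monomial n (the_inv_into L ?P b) x) b" if "b \<in> ?P ` L" for b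
      using that L(2) by (auto simp: eigen the_inv_into_f_f)
  qed (rule L)+
  also have "\<dots> = (\<Sum>C\<in>L. diagram_monomial n C x)"
    using L(2) by (simp add: sum.reindex the_inv_into_f_f)
  finally show ?thesis .
qed

lemma schur_char_upper_bound_iff:
  assumes D: "D \<subseteq> {1..n} \<times> {1..n}"
  shows "(\<forall>x. (\<forall>i\<in>{1..n}. x i \<noteq> 0) \<longrightarrow>
            schur_char n D x = (\<Sum>C\<in>same_column_sizes n D. diagram_monomial n C x)) \<longleftrightarrow>
         inj_on (weyl_gen n D) (same_column_sizes n D) \<and>
         ypoly.independent (weyl_gen n D ` same_column_sizes n D)"
proof -
  let ?P = "weyl_gen n D" and ?K = "same_column_sizes n D"
  have module: "weyl_module n D = ypoly.span (?P ` ?K)"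
    by (simp add: weyl_module_def weyl_gen_def[abs_def])
  show ?thesis
  proof (intro iffI allI impI)
    fix x :: "nat \<Rightarrow> complex"
    assume "inj_on ?P ?K \<and> ypoly.independent (?P ` ?K)" "\<forall>i\<in>{1..n}. x i \<noteq> 0"
    then show "schur_char n D x = (\<Sum>C\<in>?K. diagram_monomial n C x)"
      by (intro schur_char_basis[OF D]) (simp_all add: module)
  next
    assume *: "\<forall>x. (\<forall>i\<in>{1..n}. x i \<noteq> 0) \<longrightarrow>
      schur_char n D x = (\<Sum>C\<in>?K. diagram_monomial n C x)"
    obtain B where B: "B \<subseteq> ?P ` ?K" "ypoly.independent B" "?P ` ?K \<subseteq> ypoly.span B"
      by (rule ypoly.maximal_independent_subset)
    \<comment> \<open>\<open>L\<close> has one diagram for each element of \<open>B\<close>. At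
      \<open>x = 1\<close> all monomials are 1, so the two expressions for the character count
      \<open>L\<close> and \<open>?K\<close>.\<close>
    obtain L where L: "L \<subseteq> ?K" "inj_on ?P L" "B = ?P ` L"
      using B(1) by (auto simp: subset_image_inj)
    have "ypoly.span B = weyl_module n D"
      unfolding module using ypoly.span_mono[OF B(1)] ypoly.span_minimal[OF B(3) ypoly.subspace_span]
      by (rule subset_antisym)
    then have "schur_char n D (\<lambda>_. 1) = (\<Sum>C\<in>L. diagram_monomial n C (\<lambda>_. 1))"
      using L B(2) by (intro schur_char_basis[OF D]) simp_all
    moreover have "schur_char n D (\<lambda>_. 1) = (\<Sum>C\<in>?K. diagram_monomial n C (\<lambda>_. 1))"
      using * by simp
    ultimately have "card L = card ?K"
      by (simp add: diagram_monomial_def)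
    then have "L = ?K"
      using L(1) finite_same_column_sizes card_subset_eq by blast
    then show "inj_on ?P ?K \<and> ypoly.independent (?P ` ?K)"
      using L B by auto
  qed
qed

section \<open>Independence for pairwise disjoint columns\<close>

lemma diagram_eqI:
  assumes "C \<subseteq> {1..n} \<times> {1..n}" "C' \<subseteq> {1..n} \<times> {1..n}"
    and "\<And>j. j \<in> {1..n} \<Longrightarrow> diagram_column C j = diagram_column C' j"
  shows "C = C'"
proof -
  have "(i, j) \<in> C \<longleftrightarrow> (i, j) \<in> C'" for i j
  proof (cases "j \<in> {1..n}")
    case True
    from assms(3)[OF this] show ?thesis
      unfolding diagram_column_def by blast
  next
    case False
    with assms(1,2) show ?thesis
      by auto
  qed
  then show ?thesis
    by auto
qed

lemma weyl_gen_independent: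
  assumes D: "D \<subseteq> {1..n} \<times> {1..n}"
    and disjoint: "\<And>j k. \<lbrakk>j \<in> {1..n}; k \<in> {1..n}; j \<noteq> k\<rbrakk> \<Longrightarrow>
      diagram_column D j \<inter> diagram_column D k = {}"
  shows "inj_on (weyl_gen n D) (same_column_sizes n D) \<and>
    ypoly.independent (weyl_gen n D ` same_column_sizes n D)"
proof -
  let ?P = "weyl_gen n D" and ?K = "same_column_sizes n D"
  \<comment> \<open>\<open>E C\<close> is the support of a 0/1-matrix: its column at the
    \<open>i\<close>-th element of the set \<open>diagram_column D j\<close> has a 1 in the row
    given by the \<open>i\<close>-th element of \<open>diagram_column C j\<close>.\<close>
  define E :: "(nat \<times> nat) set \<Rightarrow> nat \<Rightarrow> nat \<Rightarrow> bool" where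
    "E C r s \<longleftrightarrow> (\<exists>j\<in>{1..n}. \<exists>i<card (diagram_column D j).
       s = increasing_enum (diagram_column D j) i \<and> r = increasing_enum (diagram_column C j) i)" for C r s
  define \<theta> :: "(nat \<times> nat) set \<Rightarrow> nat \<times> nat \<Rightarrow> ypoly" where
    "\<theta> C = (\<lambda>(r, s). if E C r s then 1 else 0)" for C
  have DU: "diagram_column D j \<subseteq> {1..n}" for j
    by (rule diagram_column_subset[OF D])
  have fin: "finite U" "0 \<notin> U" if "U \<subseteq> {1..n}" for U
    using that finite_subset[OF that] by auto
  \<comment> \<open>Disjointness makes the pair \<open>(j, i)\<close> unique for a given column
    index, so no second 1 can occur in that column.\<close>
  have E_iff: "E C r (increasing_enum (diagram_column D j) i) \<longleftrightarrow> r = increasing_enum (diagram_column C j) i"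
    if j: "j \<in> {1..n}" and i: "i < card (diagram_column D j)" for C r j i
  proof
    assume "E C r (increasing_enum (diagram_column D j) i)"
    then obtain k l where kl: "k \<in> {1..n}" "l < card (diagram_column D k)"
      "increasing_enum (diagram_column D j) i = increasing_enum (diagram_column D k) l" "r = increasing_enum (diagram_column C k) l"
      by (auto simp: E_def)
    have "increasing_enum (diagram_column D j) i \<in> diagram_column D j \<inter> diagram_column D k"
      using increasing_enum_in[OF fin[OF DU[of j]] i] increasing_enum_in[OF fin[OF DU[of k]] kl(2)] kl(3) by simp
    then have k: "k = j"
      using disjoint[OF j kl(1)] by blast
    have "inj_on (increasing_enum (diagram_column D j)) {0..<card (diagram_column D j)}"
      using bij_betw_increasing_enum[OF fin[OF DU[of j]]] by (simp add: bij_betw_def)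
    then have "l = i"
      using kl(2,3) i k by (auto dest: inj_onD)
    with kl(4) k show "r = increasing_enum (diagram_column C j) i"
      by simp
  next
    assume "r = increasing_enum (diagram_column C j) i"
    with j i show "E C r (increasing_enum (diagram_column D j) i)"
      by (auto simp: E_def)
  qed
  have minor: "ysubst (\<theta> C) (Yminor n (diagram_column C' j) (diagram_column D j)) =
      Determinant.det (Matrix.mat (card (diagram_column D j)) (card (diagram_column D j)) (\<lambda>(i, l).
        if increasing_enum (diagram_column C' j) i = increasing_enum (diagram_column C j) l then 1 else 0))"
    if "C' \<in> ?K" "j \<in> {1..n}" for C C' j
  proof -
    let ?p = "card (diagram_column D j)"
    have "ysubst (\<theta> C) (Yminor n (diagram_column C' j) (diagram_column D j)) =
      Determinant.det (Matrix.mat ?p ?p (\<lambda>(i, l).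
        \<theta> C (increasing_enum (diagram_column C' j) i, increasing_enum (diagram_column D j) l)))"
      using same_column_sizesD[OF that(1)] that(2) DU by (intro ysubst_Yminor) auto
    also have "Matrix.mat ?p ?p (\<lambda>(i, l).
        \<theta> C (increasing_enum (diagram_column C' j) i, increasing_enum (diagram_column D j) l)) =
      Matrix.mat ?p ?p (\<lambda>(i, l).
        if increasing_enum (diagram_column C' j) i = increasing_enum (diagram_column C j) l then 1 else 0)"
      using that(2) by (intro eq_matI) (auto simp: \<theta>_def E_iff)
    finally show ?thesis .
  qed
  have same: "ysubst (\<theta> C) (?P C) = 1" if C: "C \<in> ?K" for C
  proof -
    have "ysubst (\<theta> C) (Yminor n (diagram_column C j) (diagram_column D j)) = 1"
      if j: "j \<in> {1..n}" for j
    proof -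
      let ?p = "card (diagram_column D j)"
      have inj: "inj_on (increasing_enum (diagram_column C j)) {0..<?p}"
        using bij_betw_increasing_enum[OF fin[OF same_column_sizesD(1)[OF C, of j]]]
          same_column_sizesD(2)[OF C j] by (simp add: bij_betw_def)
      have "Matrix.mat ?p ?p (\<lambda>(i, l).
        if increasing_enum (diagram_column C j) i = increasing_enum (diagram_column C j) l then 1 else 0) = (1\<^sub>m ?p :: ypoly mat)"
        using inj by (intro eq_matI) (auto dest: inj_onD)
      then show ?thesis
        by (simp only: minor[OF C j] det_one)
    qed
    then show ?thesis
      by (simp add: weyl_gen_def ysubst.hom_prod)
  qed
  have diff: "ysubst (\<theta> C) (?P C') = 0" if C: "C \<in> ?K" "C' \<in> ?K" "C \<noteq> C'" for C C'
  proof -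
    obtain j where j: "j \<in> {1..n}" "diagram_column C j \<noteq> diagram_column C' j"
      using diagram_eqI[of C n C'] C by (auto simp: same_column_sizes_def)
    let ?p = "card (diagram_column D j)"
    have card: "card (diagram_column C j) = ?p" "card (diagram_column C' j) = ?p"
      using same_column_sizesD(2) C j(1) by auto
    have fin_C: "finite (diagram_column C j)" "0 \<notin> diagram_column C j"
      "finite (diagram_column C' j)" "0 \<notin> diagram_column C' j"
      using fin[OF same_column_sizesD(1)[OF C(1)]] fin[OF same_column_sizesD(1)[OF C(2)]] by auto
    \<comment> \<open>Two different finite sets of equal size: some row \<open>r\<close> of
      \<open>C'\<close> is missing from \<open>C\<close>, and it becomes a zero row of the evaluated
      minor.\<close>
    have "\<not> diagram_column C' j \<subseteq> diagram_column C j"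
      using card_subset_eq[of "diagram_column C j" "diagram_column C' j"] fin_C(1) card j(2) by metis
    then obtain r where r: "r \<in> diagram_column C' j" "r \<notin> diagram_column C j"
      by blast
    have "r \<in> increasing_enum (diagram_column C' j) ` {0..<?p}"
      using bij_betw_increasing_enum[OF fin_C(3,4)] r(1) card(2) by (simp add: bij_betw_def)
    then obtain i where i: "i < ?p" "r = increasing_enum (diagram_column C' j) i"
      by auto
    have row: "increasing_enum (diagram_column C' j) i \<noteq> increasing_enum (diagram_column C j) l" if "l < ?p" for l
      using increasing_enum_in[OF fin_C(1,2)] that card r(2) i(2) by metis
    have "(\<Prod>a = 0..<?p. if increasing_enum (diagram_column C' j) a = increasing_enum (diagram_column C j) (\<pi> a)
        then 1 else 0) = (0 :: ypoly)" if "\<pi> permutes {0..<?p}" for \<pi>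
      using i row[of "\<pi> i"] permutes_lt[OF that] by (intro prod_zero) auto
    then have "ysubst (\<theta> C) (Yminor n (diagram_column C' j) (diagram_column D j)) = 0"
      unfolding minor[OF C(2) j(1)]
      by (subst det_def'[of _ ?p]) (auto intro!: sum.neutral simp: permutes_lt cong: prod.cong)
    with j(1) show ?thesis
      by (auto simp: weyl_gen_def ysubst.hom_prod)
  qed
  have inj: "inj_on ?P ?K"
    using same diff by (intro inj_onI) (metis zero_neq_one)
  have "ypoly.independent (?P ` ?K)"
  proof
    assume "ypoly.dependent (?P ` ?K)"
    then obtain u where u: "\<exists>v\<in>?P ` ?K. u v \<noteq> 0" "(\<Sum>v\<in>?P ` ?K. yscale (u v) v) = 0"
      unfolding ypoly.dependent_finite[OF finite_imageI[OF finite_same_column_sizes]] by blast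
    then obtain C where C: "C \<in> ?K" "u (?P C) \<noteq> 0"
      by blast
    \<comment> \<open>By duality, the evaluation at \<open>C\<close> isolates the coefficient of
      \<open>?P C\<close>.\<close>
    have "0 = ysubst (\<theta> C) (\<Sum>C'\<in>?K. yscale (u (?P C')) (?P C'))"
      using u(2) by (simp add: sum.reindex[OF inj])
    also have "\<dots> = (\<Sum>C'\<in>?K. if C' = C then yscale (u (?P C)) 1 else 0)"
      unfolding ysubst_sum using C(1) by (intro sum.cong) (auto simp: ysubst_yscale same diff)
    also have "\<dots> = yscale (u (?P C)) 1"
      using C(1) finite_same_column_sizes by simp
    finally show False
      using C(2) by simp
  qed
  with inj show ?thesis
    by blast
qed

subsection \<open>Linear relations between products of minors\<close>

lemma signof_ypoly: "signof \<pi> * v = yscale (of_int (sign \<pi>)) v"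
  using sign_cases[of \<pi>] by (auto simp: yscale_def yconst_def simp flip: single_uminus)

lemma ypoly_eq_neg_self: "p = - p \<Longrightarrow> p = (0 :: ypoly)"
proof (rule poly_mapping_eqI)
  fix m
  assume "p = - p"
  then have "Poly_Mapping.lookup p m = - Poly_Mapping.lookup p m"
    by (metis lookup_uminus)
  then show "Poly_Mapping.lookup p m = Poly_Mapping.lookup 0 m"
    by simp
qed

section \<open>Minors with rows in arbitrary order\<close>

lemma det_yvar_not_inj:
  assumes "\<not> inj_on r {0..<p}"
  shows "Determinant.det (Matrix.mat p p (\<lambda>(i, j). yvar (r i, s j))) = 0"
proof -
  obtain i j where "i < p" "j < p" "i \<noteq> j" "r i = r j"
    using assms by (auto simp: inj_on_def)
  then show ?thesis
    by (intro det_identical_rows[of _ p i j]) (auto intro!: eq_vecI)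
qed

text \<open>Sorting the rows costs only a sign, of which later arguments use just that it is
  nonzero.\<close>

lemma det_yvar_inj:
  assumes inj: "inj_on r {0..<p}" and r: "r ` {0..<p} \<subseteq> {1..n}"
    and S: "S \<subseteq> {1..n}" "card S = p"
  obtains c where "c \<noteq> 0"
    "Determinant.det (Matrix.mat p p (\<lambda>(i, j). yvar (r i, increasing_enum S j))) =
      yscale c (Yminor n (r ` {0..<p}) S)"
proof -
  let ?R = "r ` {0..<p}"
  have card: "card ?R = p"
    using card_image[OF inj] by simp
  have bij: "bij_betw (increasing_enum ?R) {0..<p} ?R"
    using bij_betw_increasing_enum[of ?R] subsetD[OF r, of 0] card by auto
  \<comment> \<open>\<open>\<pi> i\<close> is the position of the row \<open>r i\<close> in
    increasing order.\<close>
  define \<pi> where "\<pi> i = (if i \<in> {0..<p} then inv_into {0..<p} (increasing_enum ?R) (r i) else i)" for i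
  have "bij_betw (inv_into {0..<p} (increasing_enum ?R) \<circ> r) {0..<p} {0..<p}"
    by (rule bij_betw_trans[OF inj_on_imp_bij_betw[OF inj] bij_betw_inv_into[OF bij]])
  then have "bij_betw \<pi> {0..<p} {0..<p}"
    by (rule bij_betw_cong[THEN iffD1, rotated]) (simp add: \<pi>_def)
  then have \<pi>: "\<pi> permutes {0..<p}"
    by (rule bij_imp_permutes) (simp add: \<pi>_def)
  have enum_\<pi>: "increasing_enum ?R (\<pi> i) = r i" if "i < p" for i
    using that bij by (simp add: \<pi>_def f_inv_into_f bij_betw_def)
  let ?M = "Matrix.mat p p (\<lambda>(i, j). yvar (increasing_enum ?R i, increasing_enum S j))"
  have "Matrix.mat p p (\<lambda>(i, j). yvar (r i, increasing_enum S j)) = Matrix.mat p p (\<lambda>(i, j). ?M $$ (\<pi> i, j))"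
    using permutes_lt[OF \<pi>] by (intro eq_matI) (auto simp: enum_\<pi>)
  then have "Determinant.det (Matrix.mat p p (\<lambda>(i, j). yvar (r i, increasing_enum S j))) =
      yscale (of_int (sign \<pi>)) (Yminor n ?R S)"
    using det_permute_rows[of ?M p \<pi>] \<pi> Yminor_eq_det[OF r S(1) card S(2)]
    by (simp add: signof_ypoly)
  then show thesis
    by (rule that[rotated]) (simp add: sign_def)
qed

text \<open>After expanding the determinant, each term involves at most \<open>card (c ` {0..<N})\<close>
  column vectors, and antisymmetrising in more than that many rows gives \<open>0\<close>.\<close>

lemma antisymmetrised_det_eq_0:
  fixes f y :: "nat \<Rightarrow> nat \<Rightarrow> ypoly"
  assumes few: "card (c ` {0..<N}) < card I" and I: "I \<subseteq> {0..<N}"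
  shows "(\<Sum>\<sigma> | \<sigma> permutes I. signof \<sigma> *
    Determinant.det (Matrix.mat N N (\<lambda>(i, j). f i j * y (\<sigma> i) (c j)))) = 0"
proof -
  have zero: "(\<Sum>\<sigma> | \<sigma> permutes I. signof \<sigma> * (\<Prod>i = 0..<N. y (\<sigma> i) (c (\<tau> i)))) = 0"
    if \<tau>: "\<tau> permutes {0..<N}" for \<tau>
  proof -
    \<comment> \<open>Pigeonhole: two rows in \<open>I\<close> are assigned the same column.
      Exchanging them preserves the product and reverses the sign, so the sum equals its own
      negative.\<close>
    have "(\<lambda>i. c (\<tau> i)) ` I \<subseteq> c ` {0..<N}"
      using permutes_lt[OF \<tau>] I by (auto simp: subset_iff)
    then have "card ((\<lambda>i. c (\<tau> i)) ` I) < card I"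
      using few by (meson card_mono finite_atLeastLessThan finite_imageI order_le_less_trans)
    then have "\<not> inj_on (\<lambda>i. c (\<tau> i)) I"
      using card_image by fastforce
    then obtain a b where ab: "a \<in> I" "b \<in> I" "a \<noteq> b" "c (\<tau> a) = c (\<tau> b)"
      by (auto simp: inj_on_def)
    let ?t = "Transposition.transpose a b"
    have t: "?t permutes I" "?t permutes {0..<N}"
      using ab I by (auto intro!: permutes_swap_id)
    let ?f = "\<lambda>\<sigma>. signof \<sigma> * (\<Prod>i = 0..<N. y (\<sigma> i) (c (\<tau> i)))"
    have "(\<Sum>\<sigma> | \<sigma> permutes I. ?f \<sigma>) = (\<Sum>\<sigma> | \<sigma> permutes I. ?f (\<sigma> \<circ> ?t))"
      by (rule sum_permutations_compose_right[OF t(1)])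
    also have "\<dots> = (\<Sum>\<sigma> | \<sigma> permutes I. - ?f \<sigma>)"
    proof (rule sum.cong[OF refl])
      fix \<sigma> assume "\<sigma> \<in> {\<sigma>. \<sigma> permutes I}"
      then have "permutation \<sigma>" "permutation ?t"
        using I finite_subset[OF I] by (auto intro: permutes_imp_permutation permutation_swap_id)
      then have sgn: "sign (\<sigma> \<circ> ?t) = - sign \<sigma>"
        using ab(3) by (simp add: sign_compose sign_swap_id)
      have "(\<Prod>i = 0..<N. y (\<sigma> (?t i)) (c (\<tau> i))) = (\<Prod>i = 0..<N. y (\<sigma> (?t i)) (c (\<tau> (?t i))))"
        using ab(4) by (intro prod.cong) (auto simp: Transposition.transpose_def)
      also have "\<dots> = (\<Prod>i = 0..<N. y (\<sigma> i) (c (\<tau> i)))"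
        using prod.permute[OF t(2), of "\<lambda>i. y (\<sigma> i) (c (\<tau> i))"] by (simp add: o_def)
      finally show "?f (\<sigma> \<circ> ?t) = - ?f \<sigma>"
        using sgn by simp
    qed
    finally show ?thesis
      by (intro ypoly_eq_neg_self) (simp add: sum_negf)
  qed
  \<comment> \<open>In the Leibniz expansion the factors \<open>f\<close> do not depend on
    \<open>\<sigma>\<close>; after exchanging the sums, \<open>zero\<close> applies for each
    \<open>\<tau>\<close>.\<close>
  have "(\<Sum>\<sigma> | \<sigma> permutes I. signof \<sigma> *
      Determinant.det (Matrix.mat N N (\<lambda>(i, j). f i j * y (\<sigma> i) (c j)))) =
    (\<Sum>\<sigma> | \<sigma> permutes I. \<Sum>\<tau> | \<tau> permutes {0..<N}. signof \<tau> * (\<Prod>i = 0..<N. f i (\<tau> i)) *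
      (signof \<sigma> * (\<Prod>i = 0..<N. y (\<sigma> i) (c (\<tau> i)))))"
  proof (rule sum.cong[OF refl])
    fix \<sigma>
    have "Determinant.det (Matrix.mat N N (\<lambda>(i, j). f i j * y (\<sigma> i) (c j))) =
      (\<Sum>\<tau> | \<tau> permutes {0..<N}. signof \<tau> * (\<Prod>i = 0..<N. f i (\<tau> i) * y (\<sigma> i) (c (\<tau> i))))"
      by (subst det_def'[of _ N]) (auto intro!: sum.cong prod.cong simp: permutes_lt)
    then show "signof \<sigma> * Determinant.det (Matrix.mat N N (\<lambda>(i, j). f i j * y (\<sigma> i) (c j))) =
      (\<Sum>\<tau> | \<tau> permutes {0..<N}. signof \<tau> * (\<Prod>i = 0..<N. f i (\<tau> i)) *
        (signof \<sigma> * (\<Prod>i = 0..<N. y (\<sigma> i) (c (\<tau> i)))))"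
      by (simp add: prod.distrib sum_distrib_left mult_ac)
  qed
  also have "\<dots> = (\<Sum>\<tau> | \<tau> permutes {0..<N}. signof \<tau> * (\<Prod>i = 0..<N. f i (\<tau> i)) *
      (\<Sum>\<sigma> | \<sigma> permutes I. signof \<sigma> * (\<Prod>i = 0..<N. y (\<sigma> i) (c (\<tau> i)))))"
    by (subst sum.swap) (simp add: sum_distrib_left)
  also have "\<dots> = 0"
    by (rule sum.neutral) (simp add: zero)
  finally show ?thesis .
qed

text \<open>This applies to \<^typ>\<open>ypoly\<close>, which is of class \<open>idom\<close> only because \<open>Product_Lexorder\<close> orders
  the indices \<open>(i, j)\<close> linearly.\<close>

lemma det_block_diag:
  fixes F :: "nat \<Rightarrow> nat \<Rightarrow> 'a :: idom"
  shows "Determinant.det (Matrix.mat (p + q) (p + q) (\<lambda>(i, j). of_bool (i < p \<longleftrightarrow> j < p) * F i j)) =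
    Determinant.det (Matrix.mat p p (\<lambda>(i, j). F i j)) *
    Determinant.det (Matrix.mat q q (\<lambda>(i, j). F (p + i) (p + j)))"
proof -
  let ?A = "Matrix.mat p p (\<lambda>(i, j). F i j)" and ?B = "Matrix.mat q q (\<lambda>(i, j). F (p + i) (p + j))"
  have "Matrix.mat (p + q) (p + q) (\<lambda>(i, j). of_bool (i < p \<longleftrightarrow> j < p) * F i j) =
      four_block_mat ?A (0\<^sub>m p q) (0\<^sub>m q p) ?B"
    by (intro eq_matI) auto
  then show ?thesis
    using det_four_block_mat_lower_left_zero[of ?A p "0\<^sub>m p q" q "0\<^sub>m q p" ?B] by simp
qed

text \<open>If the family were independent, taking the coefficient of one product would be a linear
  functional. On the vanishing antisymmetrised sum it gives a nonzero constant times the number of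
  block-preserving permutations, a contradiction.\<close>

lemma weyl_gen_dependent:
  assumes D: "D \<subseteq> {1..n} \<times> {1..n}"
    and jk: "j \<in> {1..n}" "k \<in> {1..n}" "j \<noteq> k"
    and common: "diagram_column D j \<inter> diagram_column D k \<noteq> {}"
    and m: "m \<in> {1..n}" "m \<notin> diagram_column D j" "m \<notin> diagram_column D k"
    and inj: "inj_on (weyl_gen n D) (same_column_sizes n D)"
  shows "ypoly.dependent (weyl_gen n D ` same_column_sizes n D)"
proof (rule ccontr)
  let ?P = "weyl_gen n D" and ?K = "same_column_sizes n D"
  assume indep: "ypoly.independent (?P ` ?K)"
  define S T where "S = diagram_column D j" and "T = diagram_column D k"
  have ST: "S \<subseteq> {1..n}" "T \<subseteq> {1..n}"
    unfolding S_def T_def by (rule diagram_column_subset[OF D])+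
  have fin: "finite S" "finite T"
    using ST finite_subset by blast+
  have not_0: "0 \<notin> S" "0 \<notin> T"
    using ST by auto
  define p q g N where "p = card S" and "q = card T" and "g = card (S \<inter> T) - 1" and "N = p + q"
  have "card (S \<inter> T) > 0"
    using common fin by (simp add: S_def T_def card_gt_0_iff)
  then have g_Suc: "Suc g = card (S \<inter> T)"
    by (simp add: g_def)
  have g: "g < p" "g < q"
    using g_Suc card_mono[OF fin(1), of "S \<inter> T"] card_mono[OF fin(2), of "S \<inter> T"]
    by (auto simp: p_def q_def)
  \<comment> \<open>Hence \<open>{g..<N}\<close> has \<open>card (S \<union> T) + 1\<close>
    elements, one more than there are columns.\<close>
  have card_Un: "card (S \<union> T) + Suc g = N"
    using card_Un_Int[OF fin] g_Suc by (simp add: p_def q_def N_def)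
  \<comment> \<open>The row \<open>m\<close> outside \<open>S \<union> T\<close> leaves room in
    \<open>{1..n}\<close> for that many distinct rows.\<close>
  have "card (S \<union> T) < card {1..n}"
    using ST m by (intro psubset_card_mono) (auto simp: S_def T_def)
  then have N_n: "N - g \<le> n"
    using card_Un by simp

  \<comment> \<open>Rows \<open>i < p\<close> belong to the \<open>S\<close>-minor, the others to the \<open>T\<close>-minor. The first \<open>g\<close> rows stay
    fixed and repeat rows of the \<open>T\<close>-minor, so that no more than \<open>n\<close> rows are needed.\<close>
  define \<rho> where "\<rho> i = (if i < g then p + i - g + 1 else i - g + 1)" for i
  have \<rho>_n: "\<rho> i \<in> {1..n}" if "i < N" for i
    using that N_n g by (auto simp: \<rho>_def N_def)
  have inj_I: "inj_on \<rho> {g..<N}"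
    by (auto simp: inj_on_def \<rho>_def)
  have \<rho>_p: "inj_on \<rho> {0..<p}"
    using g by (auto simp: inj_on_def \<rho>_def)
  have \<rho>_q: "inj_on (\<lambda>i. \<rho> (p + i)) {0..<q}"
    using g by (auto simp: inj_on_def \<rho>_def)
  let ?I = "{g..<N}"

  \<comment> \<open>\<open>c\<close> lists the columns of \<open>S\<close>, then those of
    \<open>T\<close>. The factor \<open>of_bool\<close> in \<open>M\<close> depends on the position
    \<open>i\<close>, not on \<open>\<sigma> i\<close>, so every \<open>M \<sigma>\<close> is block
    diagonal and its determinant is a product of two determinants.\<close>
  define c where "c i = (if i < p then increasing_enum S i else increasing_enum T (i - p))" for i
  define M where "M \<sigma> = Matrix.mat N N (\<lambda>(i, l). of_bool (i < p \<longleftrightarrow> l < p) * yvar (\<rho> (\<sigma> i), c l))"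
    for \<sigma>
  define F where "F \<sigma> = Determinant.det (Matrix.mat p p (\<lambda>(i, l). yvar (\<rho> (\<sigma> i), increasing_enum S l)))" for \<sigma>
  define H where "H \<sigma> = Determinant.det (Matrix.mat q q (\<lambda>(i, l). yvar (\<rho> (\<sigma> (p + i)), increasing_enum T l)))" for \<sigma>
  have det_M: "Determinant.det (M \<sigma>) = F \<sigma> * H \<sigma>" for \<sigma>
  proof -
    have "Matrix.mat p p (\<lambda>(i, l). yvar (\<rho> (\<sigma> i), c l)) =
        Matrix.mat p p (\<lambda>(i, l). yvar (\<rho> (\<sigma> i), increasing_enum S l))"
      "Matrix.mat q q (\<lambda>(i, l). yvar (\<rho> (\<sigma> (p + i)), c (p + l))) =
        Matrix.mat q q (\<lambda>(i, l). yvar (\<rho> (\<sigma> (p + i)), increasing_enum T l))"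
      by (auto intro!: eq_matI simp: c_def)
    then show ?thesis
      unfolding M_def F_def H_def N_def
      using det_block_diag[of p q "\<lambda>i l. yvar (\<rho> (\<sigma> i), c l)"] by simp
  qed
  have alternating: "(\<Sum>\<sigma> | \<sigma> permutes ?I. signof \<sigma> * Determinant.det (M \<sigma>)) = 0"
    unfolding M_def
  proof (rule antisymmetrised_det_eq_0)
    have "c i \<in> S \<union> T" if "i < N" for i
      using that increasing_enum_in[OF fin(1) not_0(1), of i] increasing_enum_in[OF fin(2) not_0(2), of "i - p"]
      by (auto simp: c_def p_def q_def N_def)
    then have "c ` {0..<N} \<subseteq> S \<union> T"
      by (intro image_subsetI) simp
    then have "card (c ` {0..<N}) \<le> card (S \<union> T)"
      using fin by (intro card_mono) auto
    then show "card (c ` {0..<N}) < card ?I"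
      using card_Un by simp
  qed auto

  \<comment> \<open>\<open>C \<sigma>\<close> records the rows of the two determinants in columns
    \<open>j\<close> and \<open>k\<close>; the other columns stay those of \<open>D\<close> and give
    the common factor \<open>W\<close>.\<close>
  define cols where "cols \<sigma> l =
    (if l = j then (\<lambda>i. \<rho> (\<sigma> i)) ` {0..<p}
     else if l = k then (\<lambda>i. \<rho> (\<sigma> (p + i))) ` {0..<q}
     else diagram_column D l)" for \<sigma> l
  define C where "C \<sigma> = {(i, l). l \<in> {1..n} \<and> i \<in> cols \<sigma> l}" for \<sigma>
  have col_C: "diagram_column (C \<sigma>) l = cols \<sigma> l" if "l \<in> {1..n}" for \<sigma> l
    using that by (auto simp: C_def diagram_column_def)
  define W where "W = (\<Prod>l\<in>{1..n} - {j, k}. Yminor n (diagram_column D l) (diagram_column D l))"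
  define X where "X \<sigma> = Determinant.det (M \<sigma>) * W" for \<sigma>
  have \<sigma>_N: "\<sigma> permutes {0..<N}" if "\<sigma> permutes ?I" for \<sigma>
    using that by (rule permutes_subset) auto
  \<comment> \<open>Each \<open>X \<sigma>\<close> is either 0, because of a repeated row, or by
    \<open>X_inj\<close> a nonzero multiple of a product in the family.\<close>
  have not_inj: "X \<sigma> = 0"
    if "\<not> (inj_on (\<lambda>i. \<rho> (\<sigma> i)) {0..<p} \<and> inj_on (\<lambda>i. \<rho> (\<sigma> (p + i))) {0..<q})" for \<sigma>
    using that det_yvar_not_inj[of "\<lambda>i. \<rho> (\<sigma> i)" p] det_yvar_not_inj[of "\<lambda>i. \<rho> (\<sigma> (p + i))" q]
    by (auto simp: X_def det_M F_def H_def)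
  have X_inj: "C \<sigma> \<in> ?K \<and> (\<exists>a. a \<noteq> 0 \<and> X \<sigma> = yscale a (?P (C \<sigma>)))"
    if \<sigma>: "\<sigma> permutes ?I" and inj1: "inj_on (\<lambda>i. \<rho> (\<sigma> i)) {0..<p}"
      and inj2: "inj_on (\<lambda>i. \<rho> (\<sigma> (p + i))) {0..<q}" for \<sigma>
  proof -
    have rows: "(\<lambda>i. \<rho> (\<sigma> i)) ` {0..<p} \<subseteq> {1..n}" "(\<lambda>i. \<rho> (\<sigma> (p + i))) ` {0..<q} \<subseteq> {1..n}"
      using \<rho>_n permutes_lt[OF \<sigma>_N[OF \<sigma>]] by (auto simp: N_def)
    have "cols \<sigma> l \<subseteq> {1..n}" for l
      unfolding cols_def using rows diagram_column_subset[OF D] by simp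
    moreover have "card (cols \<sigma> l) = card (diagram_column D l)" for l
      using card_image[OF inj1] card_image[OF inj2]
      by (simp add: cols_def p_def q_def S_def T_def)
    ultimately have "C \<sigma> \<in> ?K"
      using col_C by (auto simp: same_column_sizes_def C_def)
    obtain a where a: "a \<noteq> 0" "F \<sigma> = yscale a (Yminor n (cols \<sigma> j) S)"
      unfolding F_def cols_def using det_yvar_inj[OF inj1 rows(1) ST(1)] p_def by auto
    obtain b where b: "b \<noteq> 0" "H \<sigma> = yscale b (Yminor n (cols \<sigma> k) T)"
      unfolding H_def cols_def using det_yvar_inj[OF inj2 rows(2) ST(2)] q_def jk(3) by auto
    have "?P (C \<sigma>) = (\<Prod>l\<in>{1..n}. Yminor n (cols \<sigma> l) (diagram_column D l))"
      unfolding weyl_gen_def by (rule prod.cong) (simp_all add: col_C)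
    also have "\<dots> = Yminor n (cols \<sigma> j) S * (\<Prod>l\<in>{1..n} - {j}. Yminor n (cols \<sigma> l) (diagram_column D l))"
      unfolding S_def using jk by (intro prod.remove) auto
    also have "(\<Prod>l\<in>{1..n} - {j}. Yminor n (cols \<sigma> l) (diagram_column D l)) =
        Yminor n (cols \<sigma> k) T * (\<Prod>l\<in>{1..n} - {j} - {k}. Yminor n (cols \<sigma> l) (diagram_column D l))"
      unfolding T_def using jk by (intro prod.remove) auto
    also have "(\<Prod>l\<in>{1..n} - {j} - {k}. Yminor n (cols \<sigma> l) (diagram_column D l)) = W"
      unfolding W_def by (rule prod.cong) (auto simp: cols_def)
    finally have "X \<sigma> = yscale (a * b) (?P (C \<sigma>))"
      unfolding X_def det_M a(2) b(2) by (simp add: yscale_def yconst_mult mult_ac)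
    with a(1) b(1) \<open>C \<sigma> \<in> ?K\<close> show ?thesis
      by (intro conjI exI[of _ "a * b"]) auto
  qed

  have id_perm: "id permutes ?I"
    by (rule permutes_id)
  obtain a0 where C0: "C id \<in> ?K" and a0: "a0 \<noteq> 0" "X id = yscale a0 (?P (C id))"
    using X_inj[OF id_perm] \<rho>_p \<rho>_q by auto
  \<comment> \<open>\<open>representation\<close> is linear only on the span of the basis. Extending
    to a basis of all polynomials makes the coefficient functional \<open>\<phi>\<close> linear
    everywhere.\<close>
  define B where "B = ypoly.extend_basis (?P ` ?K)"
  have B: "ypoly.independent B" "ypoly.span B = UNIV" "?P ` ?K \<subseteq> B"
    unfolding B_def using indep
    by (simp_all add: ypoly.independent_extend_basis ypoly.extend_basis_superset)
  define \<phi> where "\<phi> v = ypoly.representation B v (?P (C id))" for v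
  have \<phi>_scale: "\<phi> (yscale a v) = a * \<phi> v" for a v
    unfolding \<phi>_def using B by (simp add: ypoly.representation_scale)
  have \<phi>_P: "\<phi> (?P C') = (if C' = C id then 1 else 0)" if "C' \<in> ?K" for C'
  proof -
    have "?P C' \<in> B"
      using that B(3) by blast
    then show ?thesis
      unfolding \<phi>_def using ypoly.representation_basis[OF B(1)] inj_on_eq_iff[OF inj that C0] by auto
  qed

  \<comment> \<open>All permutations that preserve the two blocks contribute the same, so nothing cancels.\<close>
  have coeff: "\<phi> (signof \<sigma> * X \<sigma>) = (if \<sigma> ` {0..<p} \<subseteq> {0..<p} then a0 else 0)"
    if \<sigma>: "\<sigma> permutes ?I" for \<sigma>
  proof (cases "\<sigma> ` {0..<p} \<subseteq> {0..<p}")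
    case True
    have inj_\<sigma>: "inj \<sigma>"
      using \<sigma> by (rule permutes_inj)
    have "card (\<sigma> ` {0..<p}) = card {0..<p}"
      by (rule card_image) (rule inj_on_subset[OF inj_\<sigma> subset_UNIV])
    then have img: "\<sigma> ` {0..<p} = {0..<p}"
      using True by (intro card_subset_eq) auto
    have block: "\<sigma> i < p \<longleftrightarrow> i < p" for i
      using inj_image_mem_iff[OF inj_\<sigma>, of i "{0..<p}"] img by simp
    \<comment> \<open>The block condition is invariant under \<open>\<sigma>\<close>, so only rows
      are permuted, and the resulting sign cancels the one in the sum.\<close>
    have "M \<sigma> = Matrix.mat N N (\<lambda>(i, l). M id $$ (\<sigma> i, l))"
      using permutes_lt[OF \<sigma>_N[OF \<sigma>]] by (intro eq_matI) (auto simp: M_def block)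
    then have "Determinant.det (M \<sigma>) = signof \<sigma> * Determinant.det (M id)"
      using det_permute_rows[OF _ \<sigma>_N[OF \<sigma>], of "M id"] by (simp add: M_def)
    then have "signof \<sigma> * X \<sigma> = signof \<sigma> * signof \<sigma> * X id"
      by (simp add: X_def mult_ac)
    also have "signof \<sigma> * signof \<sigma> = (1 :: ypoly)"
      by (simp add: sign_def)
    finally have eq: "signof \<sigma> * X \<sigma> = yscale a0 (?P (C id))"
      by (simp only: mult_1 a0(2))
    show ?thesis
      unfolding eq \<phi>_scale \<phi>_P[OF C0] using True by simp
  next
    case False
    then obtain i where i: "i < p" "p \<le> \<sigma> i"
      by (auto simp: image_subset_iff not_less)
    have "\<sigma> i \<noteq> i"
      using i by simp
    then have "i \<in> ?I"
      using permutes_not_in[OF \<sigma>] by blast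
    then have \<sigma>i: "\<sigma> i \<in> ?I"
      using permutes_in_image[OF \<sigma>] by blast
    have "\<phi> (X \<sigma>) = 0"
    proof (cases "inj_on (\<lambda>i. \<rho> (\<sigma> i)) {0..<p} \<and> inj_on (\<lambda>i. \<rho> (\<sigma> (p + i))) {0..<q}")
      case True
      then have inj_\<sigma>: "inj_on (\<lambda>i. \<rho> (\<sigma> i)) {0..<p}" "inj_on (\<lambda>i. \<rho> (\<sigma> (p + i))) {0..<q}"
        by blast+
      then obtain a where a: "C \<sigma> \<in> ?K" "X \<sigma> = yscale a (?P (C \<sigma>))"
        using X_inj[OF \<sigma>] by blast
      \<comment> \<open>Otherwise the row of \<open>\<sigma> i\<close>, with
        \<open>\<sigma> i\<close> in the second block, is also the row of some
        \<open>i' < p\<close>. If \<open>i' < g\<close>, then \<open>\<sigma>\<close> fixes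
        \<open>i'\<close> and the first block has a repeated row; if not, injectivity of
        \<open>\<rho>\<close> on \<open>{g..<N}\<close> forces
        \<open>\<sigma> i = i' < p\<close>.\<close>
      have "C \<sigma> \<noteq> C id"
      proof
        assume "C \<sigma> = C id"
        then have "cols \<sigma> j = cols id j"
          using col_C[OF jk(1)] by metis
        then have "(\<lambda>i. \<rho> (\<sigma> i)) ` {0..<p} = \<rho> ` {0..<p}"
          by (simp add: cols_def)
        moreover have "\<rho> (\<sigma> i) \<in> (\<lambda>i. \<rho> (\<sigma> i)) ` {0..<p}"
          using i(1) by simp
        ultimately have "\<rho> (\<sigma> i) \<in> \<rho> ` {0..<p}"
          by simp
        then obtain i' where i': "i' < p" "\<rho> (\<sigma> i) = \<rho> i'"
          by auto
        show False
        proof (cases "i' < g")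
          case True
          then have "\<sigma> i' = i'"
            using permutes_not_in[OF \<sigma>] by simp
          then have "i = i'"
            using inj_onD[OF inj_\<sigma>(1), of i i'] i(1) i' by simp
          with True \<open>i \<in> ?I\<close> show False
            by simp
        next
          case False
          then have "\<sigma> i = i'"
            using inj_onD[OF inj_I i'(2) \<sigma>i] i'(1) by (simp add: N_def)
          with i i' show False
            by simp
        qed
      qed
      with a \<phi>_P show ?thesis
        by (simp add: \<phi>_scale)
    next
      case False
      then show ?thesis
        using not_inj \<phi>_scale[of 0 0] by simp
    qed
    with False show ?thesis
      by (simp add: signof_ypoly \<phi>_scale)
  qed
  \<comment> \<open>Applying \<open>\<phi>\<close> to the relation gives
    \<open>card ?Q * a0 = 0\<close>, although \<open>?Q\<close> contains \<open>id\<close>.\<close>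
  let ?Q = "{\<sigma> \<in> {\<sigma>. \<sigma> permutes ?I}. \<sigma> ` {0..<p} \<subseteq> {0..<p}}"
  have "0 = \<phi> ((\<Sum>\<sigma> | \<sigma> permutes ?I. signof \<sigma> * Determinant.det (M \<sigma>)) * W)"
    using alternating \<phi>_scale[of 0 0] by simp
  also have "\<dots> = \<phi> (\<Sum>\<sigma> | \<sigma> permutes ?I. signof \<sigma> * X \<sigma>)"
    by (simp add: sum_distrib_right X_def mult.assoc)
  also have "\<dots> = (\<Sum>\<sigma> | \<sigma> permutes ?I. \<phi> (signof \<sigma> * X \<sigma>))"
    unfolding \<phi>_def using B by (simp add: ypoly.representation_sum)
  also have "\<dots> = (\<Sum>\<sigma> | \<sigma> permutes ?I. if \<sigma> ` {0..<p} \<subseteq> {0..<p} then a0 else 0)"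
    by (rule sum.cong) (simp_all add: coeff)
  also have "\<dots> = sum (\<lambda>_. a0) ?Q"
    by (rule sum.inter_filter[symmetric]) (simp add: finite_permutations)
  finally have "card ?Q = 0"
    using a0(1) by simp
  moreover have "finite ?Q"
    using finite_permutations[of ?I] by simp
  moreover have "id \<in> ?Q"
    using id_perm by simp
  ultimately show False
    using card_0_eq by blast
qed

subsection \<open>Rothe diagrams and patterns\<close>

text \<open>Both patterns ask for an entry with two smaller entries to its right and differ only in
  the order of these two. As \<open>w\<close> is arbitrary here, their distinctness is stated
  explicitly.\<close>

lemma contains_312_or_321_iff:
  "contains_pattern n w [3, 1, 2] \<or> contains_pattern n w [3, 2, 1] \<longleftrightarrow>
    (\<exists>a b c. a \<in> {1..n} \<and> b \<in> {1..n} \<and> c \<in> {1..n} \<and> a < b \<and> b < c \<and>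
       w b < w a \<and> w c < w a \<and> w b \<noteq> w c)"
    (is "_ \<longleftrightarrow> (\<exists>a b c. ?Q a b c)")
proof
  have "\<exists>a b c. ?Q a b c" if "contains_pattern n w v" and v: "v \<in> {[3, 1, 2], [3, 2, 1]}" for v
  proof -
    from that(1)[unfolded contains_pattern_def] obtain p
      where p: "length p = length v \<and> sorted_wrt (<) p \<and> set p \<subseteq> {1..n} \<and>
        (\<forall>a<length v. \<forall>b<length v. w (p ! a) < w (p ! b) \<longleftrightarrow> v ! a < v ! b)" ..
    have len: "length v = 3"
      using v by auto
    then have "length p = Suc (Suc (Suc 0))"
      using p by simp
    then obtain a b c where abc: "p = [a, b, c]"
      by (auto simp: length_Suc_conv)
    have order: "w (p ! i) < w (p ! l) \<longleftrightarrow> v ! i < v ! l" if "i < 3" "l < 3" for i l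
      using p that len by simp
    have "?Q a b c"
      using p order[of 1 0] order[of 2 0] order[of 1 2] order[of 2 1] v
      by (auto simp: abc)
    then show ?thesis
      by blast
  qed
  then show "contains_pattern n w [3, 1, 2] \<or> contains_pattern n w [3, 2, 1] \<Longrightarrow> \<exists>a b c. ?Q a b c"
    by blast
next
  assume "\<exists>a b c. ?Q a b c"
  then obtain a b c where abc: "?Q a b c"
    by blast
  have "contains_pattern n w [3, 1, 2]" if "w b < w c"
    unfolding contains_pattern_def
    by (rule exI[of _ "[a, b, c]"]) (use abc that in \<open>auto simp: less_Suc_eq numeral_3_eq_3\<close>)
  moreover have "contains_pattern n w [3, 2, 1]" if "w c < w b"
    unfolding contains_pattern_def
    by (rule exI[of _ "[a, b, c]"]) (use abc that in \<open>auto simp: less_Suc_eq numeral_3_eq_3\<close>)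
  ultimately show "contains_pattern n w [3, 1, 2] \<or> contains_pattern n w [3, 2, 1]"
    using abc by (metis linorder_neqE_nat)
qed

lemma mem_rothe_column_iff:
  "i \<in> diagram_column (rothe_diagram n w) j \<longleftrightarrow>
    i \<in> {1..n} \<and> j \<in> {1..n} \<and> j < w i \<and> i < inv_into UNIV w j"
  by (auto simp: diagram_column_def rothe_diagram_def)

text \<open>The boxes in row \<open>a\<close> correspond to the values smaller than
  \<open>w a\<close> that stand to the right of position \<open>a\<close>; two boxes in one row are
  two such values.\<close>

lemma rothe_shared_row_iff:
  assumes w: "w permutes {1..n}"
  shows "(\<exists>j\<in>{1..n}. \<exists>k\<in>{1..n}. j \<noteq> k \<and>
      diagram_column (rothe_diagram n w) j \<inter> diagram_column (rothe_diagram n w) k \<noteq> {}) \<longleftrightarrow>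
    contains_pattern n w [3, 1, 2] \<or> contains_pattern n w [3, 2, 1]"
  unfolding contains_312_or_321_iff
proof (intro iffI)
  let ?D = "diagram_column (rothe_diagram n w)" and ?v = "inv_into UNIV w"
  assume "\<exists>j\<in>{1..n}. \<exists>k\<in>{1..n}. j \<noteq> k \<and> ?D j \<inter> ?D k \<noteq> {}"
  then obtain j k a where jk: "j \<in> {1..n}" "k \<in> {1..n}" "j \<noteq> k" "a \<in> ?D j" "a \<in> ?D k"
    by blast
  have v: "w (?v j) = j" "w (?v k) = k" "?v j \<in> {1..n}" "?v k \<in> {1..n}"
    using permutes_inverses(1)[OF w] permutes_in_image[OF permutes_inv[OF w]] jk by auto
  have a: "a \<in> {1..n}" "j < w a" "a < ?v j" "k < w a" "a < ?v k"
    using jk(4,5) by (auto simp: mem_rothe_column_iff)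
  have "?v j \<noteq> ?v k"
    using v jk(3) by metis
  then consider "?v j < ?v k" | "?v k < ?v j"
    by linarith
  then show "\<exists>a b c. a \<in> {1..n} \<and> b \<in> {1..n} \<and> c \<in> {1..n} \<and> a < b \<and> b < c \<and>
      w b < w a \<and> w c < w a \<and> w b \<noteq> w c"
    by cases (use a v jk(3) in \<open>metis+\<close>)
next
  let ?D = "diagram_column (rothe_diagram n w)"
  assume "\<exists>a b c. a \<in> {1..n} \<and> b \<in> {1..n} \<and> c \<in> {1..n} \<and> a < b \<and> b < c \<and>
      w b < w a \<and> w c < w a \<and> w b \<noteq> w c"
  then obtain a b c where abc: "a \<in> {1..n}" "b \<in> {1..n}" "c \<in> {1..n}" "a < b" "b < c"
    "w b < w a" "w c < w a" "w b \<noteq> w c"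
    by blast
  have "w b \<in> {1..n}" "w c \<in> {1..n}"
    using abc(2,3) permutes_in_image[OF w] by blast+
  moreover have "a \<in> ?D (w b) \<inter> ?D (w c)"
    using abc calculation permutes_inverses(2)[OF w] by (simp add: mem_rothe_column_iff)
  ultimately show "\<exists>j\<in>{1..n}. \<exists>k\<in>{1..n}. j \<noteq> k \<and> ?D j \<inter> ?D k \<noteq> {}"
    using abc(8) by blast
qed

theorem corollary4p3:
  fixes n :: nat and w :: "nat \<Rightarrow> nat"
  assumes "w permutes {1..n}"
  shows "stanley_attains_upper_bound n w \<longleftrightarrow>
         avoids_pattern n w [3, 1, 2] \<and> avoids_pattern n w [3, 2, 1]"
proof -
  let ?D = "rothe_diagram n w"
  have D: "?D \<subseteq> {1..n} \<times> {1..n}"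
    by (auto simp: rothe_diagram_def)
  have "stanley_attains_upper_bound n w \<longleftrightarrow>
      inj_on (weyl_gen n ?D) (same_column_sizes n ?D) \<and>
      ypoly.independent (weyl_gen n ?D ` same_column_sizes n ?D)"
    unfolding stanley_attains_upper_bound_def stanley_fun_def by (rule schur_char_upper_bound_iff[OF D])
  also have "\<dots> \<longleftrightarrow> \<not> (\<exists>j\<in>{1..n}. \<exists>k\<in>{1..n}. j \<noteq> k \<and> diagram_column ?D j \<inter> diagram_column ?D k \<noteq> {})"
  proof (intro iffI notI)
    assume *: "inj_on (weyl_gen n ?D) (same_column_sizes n ?D) \<and>
      ypoly.independent (weyl_gen n ?D ` same_column_sizes n ?D)"
    assume "\<exists>j\<in>{1..n}. \<exists>k\<in>{1..n}. j \<noteq> k \<and> diagram_column ?D j \<inter> diagram_column ?D k \<noteq> {}"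
    then obtain j k where jk: "j \<in> {1..n}" "k \<in> {1..n}" "j \<noteq> k"
      "diagram_column ?D j \<inter> diagram_column ?D k \<noteq> {}"
      by blast
    \<comment> \<open>No position lies to the right of \<open>n\<close>. This row serves as the free
      row \<open>m\<close> of \<open>weyl_gen_dependent\<close>.\<close>
    have n: "n \<notin> diagram_column ?D l" if "l \<in> {1..n}" for l
      using permutes_in_image[OF permutes_inv[OF assms], of l] that
      by (auto simp: mem_rothe_column_iff)
    show False
      using weyl_gen_dependent[OF D jk, of n] n[OF jk(1)] n[OF jk(2)] jk(1) * by auto
  next
    assume "\<not> (\<exists>j\<in>{1..n}. \<exists>k\<in>{1..n}. j \<noteq> k \<and> diagram_column ?D j \<inter> diagram_column ?D k \<noteq> {})"
    then show "inj_on (weyl_gen n ?D) (same_column_sizes n ?D) \<and>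
      ypoly.independent (weyl_gen n ?D ` same_column_sizes n ?D)"
      by (intro weyl_gen_independent[OF D]) blast
  qed
  finally show ?thesis
    unfolding rothe_shared_row_iff[OF assms] by (simp add: avoids_pattern_def)
qed

end
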